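(* Let $\mathbf L=(L,\vee,\wedge)$ be a semimodular $\lambda$-lattice satisfying the following condition: for all $x,y,z\in L$, if $x\parallel y$, $x\parallel z$ and $y<z$, then $x\wedge y\leq x\wedge z$. Then $\mathbf L$ satisfies the weak lower covering condition.
   Context: A $\lambda$-lattice is an algebra $(L,\vee,\wedge)$ with two binary operations satisfying the identities: (i) $x\vee y=y\vee x$ and $x\wedge y=y\wedge x$ (commutativity); (ii) $x\vee((x\vee y)\vee z)=(x\vee y)\vee z$ and $x\wedge((x\wedge y)\wedge z)=(x\wedge y)\wedge z$ (weak associativity); (iii) $x\vee(x\wedge y)=x$ and $x\wedge(x\vee y)=x$ (absorption). The relation $x\leq y$ is defined by $x\vee y=y$ (equivalently, $x\wedge y=x$); it is a partial order on $L$, and $x\vee y$ is an upper bound and $x\wedge y$ a lower bound of $\{x,y\}$ (not necessarily the least, respectively greatest, one). Write $x<y$ for $x\leq y$ and $x\neq y$; $x\parallel y$ means that $x$ and $y$ are incomparable (neither $x\leq y$ nor $y\leq x$); $x\prec y$ means that $y$ covers $x$, i.e. $x<y$ and there is no $z\in L$ with $x<z<y$. A $\lambda$-lattice is semimodular if for all $x,y,z\in L$ with $x\parallel y$ and $x\wedge y<z<x$ there exists some $u\in L$ with $x\wedge y<u\leq y$ and $(z\vee u)\wedge x=z$. A $\lambda$-lattice satisfies the weak lower covering condition if for all $x,y\in L$: $x\wedge y\prec x$ and $x\prec x\vee y$ together imply $y\prec x\vee y$. *)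

theory Defs
  imports Main
begin

locale lambda_lattice =
  fixes join :: "'a \<Rightarrow> 'a \<Rightarrow> 'a" (infixl "\<squnion>" 65)
    and meet :: "'a \<Rightarrow> 'a \<Rightarrow> 'a" (infixl "\<sqinter>" 70)
  assumes join_comm: "x \<squnion> y = y \<squnion> x"
    and meet_comm: "x \<sqinter> y = y \<sqinter> x"
    and join_weak_assoc: "x \<squnion> ((x \<squnion> y) \<squnion> z) = (x \<squnion> y) \<squnion> z"
    and meet_weak_assoc: "x \<sqinter> ((x \<sqinter> y) \<sqinter> z) = (x \<sqinter> y) \<sqinter> z"
    and join_absorb: "x \<squnion> (x \<sqinter> y) = x"
    and meet_absorb: "x \<sqinter> (x \<squnion> y) = x"
begin

definition le :: "'a \<Rightarrow> 'a \<Rightarrow> bool" (infix "\<sqsubseteq>" 50)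
  where "x \<sqsubseteq> y \<longleftrightarrow> x \<squnion> y = y"

definition less :: "'a \<Rightarrow> 'a \<Rightarrow> bool" (infix "\<sqsubset>" 50)
  where "x \<sqsubset> y \<longleftrightarrow> x \<sqsubseteq> y \<and> x \<noteq> y"

definition incomparable :: "'a \<Rightarrow> 'a \<Rightarrow> bool" (infix "\<parallel>" 50)
  where "x \<parallel> y \<longleftrightarrow> \<not> x \<sqsubseteq> y \<and> \<not> y \<sqsubseteq> x"

definition covered_by :: "'a \<Rightarrow> 'a \<Rightarrow> bool" (infix "\<prec>" 50)
  where "x \<prec> y \<longleftrightarrow> x \<sqsubset> y \<and> \<not> (\<exists>z. x \<sqsubset> z \<and> z \<sqsubset> y)"

definition semimodular :: bool
  where "semimodular \<longleftrightarrow>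
    (\<forall>x y z. x \<parallel> y \<and> x \<sqinter> y \<sqsubset> z \<and> z \<sqsubset> x \<longrightarrow>
      (\<exists>u. x \<sqinter> y \<sqsubset> u \<and> u \<sqsubseteq> y \<and> (z \<squnion> u) \<sqinter> x = z))"

definition weak_lower_covering_condition :: bool
  where "weak_lower_covering_condition \<longleftrightarrow>
    (\<forall>x y. x \<sqinter> y \<prec> x \<and> x \<prec> x \<squnion> y \<longrightarrow> y \<prec> x \<squnion> y)"

lemma le_iff_meet: "x \<sqsubseteq> y \<longleftrightarrow> x \<sqinter> y = x"
  unfolding le_def by (metis join_absorb join_comm meet_absorb meet_comm)

lemma le_trans: "x \<sqsubseteq> y \<Longrightarrow> y \<sqsubseteq> z \<Longrightarrow> x \<sqsubseteq> z"
  unfolding le_def by (metis join_weak_assoc)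

sublocale order le less
proof
  show "x \<sqsubset> y \<longleftrightarrow> x \<sqsubseteq> y \<and> \<not> y \<sqsubseteq> x" for x y
    unfolding less_def le_def by (metis join_comm join_absorb meet_absorb)
  show "x \<sqsubseteq> x" for x
    unfolding le_def by (metis join_absorb meet_absorb)
  show "x \<sqsubseteq> y \<Longrightarrow> y \<sqsubseteq> z \<Longrightarrow> x \<sqsubseteq> z" for x y z
    by (rule le_trans)
  show "x \<sqsubseteq> y \<Longrightarrow> y \<sqsubseteq> x \<Longrightarrow> x = y" for x y
    unfolding le_def by (metis join_comm)
qed

lemma le_join: "x \<sqsubseteq> x \<squnion> y" "y \<sqsubseteq> x \<squnion> y"
  unfolding le_iff_meet by (metis meet_absorb join_comm)+

lemma meet_le: "x \<sqinter> y \<sqsubseteq> x" "x \<sqinter> y \<sqsubseteq> y"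
  unfolding le_def by (metis join_absorb join_comm meet_comm)+

end

end

theory Submission
  imports Defs
begin

text \<open>Suppose \<open>y \<sqsubset> z \<sqsubset> x \<squnion> y\<close>. Monotonicity of the meet and the covering
  \<open>x \<sqinter> y \<prec> x\<close> force \<open>x \<sqinter> z = x \<sqinter> y\<close>. Semimodularity, applied to
  \<open>z \<sqinter> x \<sqsubset> y \<sqsubset> z\<close>, then gives \<open>u\<close> with \<open>x \<sqinter> y \<sqsubset> u \<sqsubseteq> x\<close> and
  \<open>(y \<squnion> u) \<sqinter> z = y\<close>. The covering forces \<open>u = x\<close>, whence \<open>y = (x \<squnion> y) \<sqinter> z = z\<close>.\<close>

context lambda_lattice
begin

lemma covered_by_eqI:
  assumes "x \<prec> y" "x \<sqsubset> z" "z \<sqsubseteq> y"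
  shows "z = y"
  using assms unfolding covered_by_def less_def by blast

lemma weak_lower_covering_conditionI:
  assumes semimod: semimodular
    and mono: "\<And>x y z. x \<parallel> y \<Longrightarrow> x \<parallel> z \<Longrightarrow> y \<sqsubset> z \<Longrightarrow> x \<sqinter> y \<sqsubseteq> x \<sqinter> z"
  shows weak_lower_covering_condition
  unfolding weak_lower_covering_condition_def
proof (intro allI impI, elim conjE)
  fix x y
  assume cov1: "x \<sqinter> y \<prec> x" and cov2: "x \<prec> x \<squnion> y"
  \<comment> \<open>Comparability would give \<open>x \<sqinter> y = x\<close> or
    \<open>x \<squnion> y = x\<close>, against the strictness of one of the coverings.\<close>
  have nle: "\<not> x \<sqsubseteq> y" "\<not> y \<sqsubseteq> x"
    using cov1 cov2 le_iff_meet join_comm unfolding covered_by_def less_def le_def by metis+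
  have inc: "x \<parallel> y"
    using nle by (simp add: incomparable_def)
  have "y \<sqsubset> x \<squnion> y"
    using le_join nle unfolding less_def by metis
  moreover have False if yz: "y \<sqsubset> z" and zb: "z \<sqsubset> x \<squnion> y" for z
  proof -
    have "\<not> z \<sqsubseteq> x"
      using yz nle(2) le_trans unfolding less_def by blast
    \<comment> \<open>Otherwise \<open>z\<close>, distinct from \<open>x\<close> because
      \<open>z \<sqsubseteq> x\<close> fails, would lie strictly between \<open>x\<close> and its
      cover \<open>x \<squnion> y\<close>.\<close>
    moreover have "\<not> x \<sqsubseteq> z"
      using cov2 zb \<open>\<not> z \<sqsubseteq> x\<close> refl unfolding covered_by_def less_def by blast
    ultimately have incz: "x \<parallel> z"
      by (simp add: incomparable_def)
    have "x \<sqinter> z \<noteq> x"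
      using \<open>\<not> x \<sqsubseteq> z\<close> by (simp add: le_iff_meet)
    then have meet_eq: "x \<sqinter> z = x \<sqinter> y"
      using covered_by_eqI[OF cov1] mono[OF inc incz yz] meet_le(1)[of x z]
      unfolding less_def by metis
    have "z \<parallel> x"
      using incz by (simp add: incomparable_def)
    \<comment> \<open>Equality would put \<open>y = x \<sqinter> y\<close> below
      \<open>x\<close>.\<close>
    moreover have "z \<sqinter> x \<sqsubset> y"
      using meet_eq meet_comm meet_le[of x y] nle(2) unfolding less_def by metis
    ultimately obtain u where u: "z \<sqinter> x \<sqsubset> u" "u \<sqsubseteq> x" "(y \<squnion> u) \<sqinter> z = y"
      using semimod yz unfolding semimodular_def by blast
    have "u = x"
      using covered_by_eqI[OF cov1] u meet_eq meet_comm by metis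
    \<comment> \<open>As \<open>z\<close> lies below \<open>y \<squnion> x\<close>, their meet is
      \<open>z\<close>.\<close>
    then have "y = z"
      using u(3) zb le_iff_meet join_comm meet_comm unfolding less_def by metis
    then show False
      using yz by (simp add: less_def)
  qed
  ultimately show "y \<prec> x \<squnion> y"
    unfolding covered_by_def by blast
qed

end

theorem theorem2p11:
  fixes join :: "'a \<Rightarrow> 'a \<Rightarrow> 'a" (infixl "\<squnion>" 65)
    and meet :: "'a \<Rightarrow> 'a \<Rightarrow> 'a" (infixl "\<sqinter>" 70)
  assumes "lambda_lattice (\<squnion>) (\<sqinter>)"
    and "lambda_lattice.semimodular (\<squnion>) (\<sqinter>)"
    and "\<forall>x y z. lambda_lattice.incomparable (\<squnion>) x y \<and>
           lambda_lattice.incomparable (\<squnion>) x z \<and>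
           lambda_lattice.less (\<squnion>) y z \<longrightarrow>
           lambda_lattice.le (\<squnion>) (x \<sqinter> y) (x \<sqinter> z)"
  shows "lambda_lattice.weak_lower_covering_condition (\<squnion>) (\<sqinter>)"
  using lambda_lattice.weak_lower_covering_conditionI[OF assms(1,2)] assms(3) by blast

end
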